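(* Let $\mu\in\mathbb{C}$ and $t\in\mathbb{C}\setminus(-\infty,0]$. Let $r_N(s),\bar r_N(s)$ denote the reflection coefficients $r_N(s)=(-1)^N I^1_N(s)/I^0_N(s)$, $\bar r_N(s)=(-1)^N I^{-1}_N(s)/I^0_N(s)$ with $I^\epsilon_N(s)=\det[I_{\mu+\epsilon+j-k}(\sqrt s)]_{j,k=1,\dots,N}$, and assume $I^0_N(4t)\ne0$ and $r_N(4t)\neq 0$ for all $N\ge 0$. Let $p_N,q_N$ ($N\ge 0$) be the Hamiltonian variables of the Painlevé $\mathrm{III}'$ system, i.e. the functions of $t$ determined by $$p_{N+1}=\frac{q_N^2}{t}(p_N-1)-\mu\frac{q_N}{t}+1,\qquad q_{N+1}=-\frac{t}{q_N}+\frac{(N+1)t}{q_N[q_N(p_N-1)-\mu]+t}\qquad(N\ge0)$$ with $p_0=0$ and $q_0(t)=\Big(s\frac{d}{ds}\log\big(s^{-\mu/2}I_\mu(\sqrt s)\big)\Big)\Big|_{s=4t}$. Then for all $N\ge 0$ $$p_N(t)=1-r_N(4t)\,\bar r_N(4t),\qquad q_N(t)=-\sqrt t\;\frac{r_{N+1}(4t)}{r_N(4t)}.$$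
   Context: $I_\alpha(x)$ denotes the modified Bessel function of the first kind of order $\alpha$; $\sqrt{\cdot}$ is the principal branch. Conventions: $I^\epsilon_0:=1$, so $r_0=\bar r_0=1$. The quantities $r_N$ and $\bar r_N$ are independent quantities; the bar does not mean complex conjugation. *)

theory Defs
  imports
    "HOL-Analysis.Analysis"
    "Jordan_Normal_Form.Determinant"
begin

(* I_alpha(x) = sum_k (x/2)^(2k+alpha) / (k! Gamma(alpha+k+1)) on the principal branch.
   The reciprocal Gamma function is entire and vanishes at the poles of Gamma, so negative
   integer orders are covered.  Only x \<noteq> 0 is meaningful, because 0 powr a = 0 for all a. *)
definition bessel_I :: "complex \<Rightarrow> complex \<Rightarrow> complex" where
  "bessel_I \<alpha> x =
     (x / 2) powr \<alpha> * (\<Sum>k. (x / 2) ^ (2 * k) / fact k * rGamma (\<alpha> + of_nat k + 1))"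

(* Row and column indices run over 0..N-1 instead of 1..N; the entries depend on j - k only.
   The empty determinant (N = 0) is 1. *)
definition toeplitz_I :: "complex \<Rightarrow> int \<Rightarrow> nat \<Rightarrow> complex \<Rightarrow> complex" where
  "toeplitz_I \<mu> \<epsilon> N s = Determinant.det (Matrix.mat N N
     (\<lambda>(j, k). bessel_I (\<mu> + of_int \<epsilon> + of_nat j - of_nat k) (csqrt s)))"

definition refl_coeff :: "complex \<Rightarrow> nat \<Rightarrow> complex \<Rightarrow> complex" where
  "refl_coeff \<mu> N s = (-1) ^ N * toeplitz_I \<mu> 1 N s / toeplitz_I \<mu> 0 N s"

definition refl_coeff_bar :: "complex \<Rightarrow> nat \<Rightarrow> complex \<Rightarrow> complex" where
  "refl_coeff_bar \<mu> N s = (-1) ^ N * toeplitz_I \<mu> (-1) N s / toeplitz_I \<mu> 0 N s"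

(* (d/ds) log f, read as f'/f so that no branch of the logarithm has to be chosen. *)
definition log_derivative :: "(complex \<Rightarrow> complex) \<Rightarrow> complex \<Rightarrow> complex" where
  "log_derivative f s = deriv f s / f s"

fun ham_p :: "complex \<Rightarrow> nat \<Rightarrow> complex \<Rightarrow> complex"
  and ham_q :: "complex \<Rightarrow> nat \<Rightarrow> complex \<Rightarrow> complex" where
  "ham_p \<mu> 0 t = 0"
| "ham_p \<mu> (Suc N) t =
     (ham_q \<mu> N t)\<^sup>2 / t * (ham_p \<mu> N t - 1) - \<mu> * (ham_q \<mu> N t / t) + 1"
| "ham_q \<mu> 0 t =
     4 * t * log_derivative (\<lambda>s. s powr (- \<mu> / 2) * bessel_I \<mu> (csqrt s)) (4 * t)"
| "ham_q \<mu> (Suc N) t =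
     - (t / ham_q \<mu> N t)
     + of_nat (N + 1) * t / (ham_q \<mu> N t * (ham_q \<mu> N t * (ham_p \<mu> N t - 1) - \<mu>) + t)"

end

theory Submission
  imports Defs
begin

text \<open>
  The Toeplitz matrix has the moments \<open>w\<^sub>j = I\<^bsub>\<mu>+j\<^esub>(2\<surd>t)\<close>.  Its minors give the coefficients of
  polynomials that are biorthogonal for the functional \<open>L(x\<^sup>j) = w\<^sub>j\<close>, and \<open>r\<^sub>N\<close>, \<open>r'\<^sub>N\<close> are the
  constant terms of the monic ones.  The contiguity relation of the Bessel functions says that
  \<open>L(\<surd>t (1/x - x) f) = L(x f' + \<mu> f)\<close> for every Laurent polynomial \<open>f\<close>.  Choosing for \<open>f\<close> the
  products \<open>\<phi>\<^sub>n(x) \<phi>'\<^sub>n(1/x)\<close> and \<open>x\<^sup>-\<^sup>n \<phi>\<^sub>n(x) \<phi>\<^sub>n\<^sub>+\<^sub>1(x)\<close> gives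
  \<open>\<surd>t (r\<^sub>n\<^sub>+\<^sub>1 r'\<^sub>n - r\<^sub>n r'\<^sub>n\<^sub>+\<^sub>1) = \<mu>\<close> and
  \<open>-\<surd>t (r\<^sub>n + r\<^sub>n\<^sub>+\<^sub>2) (1 - r\<^sub>n\<^sub>+\<^sub>1 r'\<^sub>n\<^sub>+\<^sub>1) = (n + 1) r\<^sub>n\<^sub>+\<^sub>1\<close>, which are equivalent to the two recurrences.
\<close>

section \<open>The moment functional of a Toeplitz matrix\<close>

text \<open>Orthogonality leaves only extreme terms of an expansion; this lemma and the next two
  extract them.\<close>

lemma sum_ends:
  fixes f :: "nat \<Rightarrow> 'a::comm_monoid_add"
  assumes "\<And>k. 0 < k \<Longrightarrow> k < Suc n \<Longrightarrow> f k = 0"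
  shows "sum f {..Suc n} = f 0 + f (Suc n)"
proof -
  have "sum f {..Suc n} = sum f {0, Suc n}"
    by (rule sum.mono_neutral_right) (use assms in \<open>auto simp: le_less\<close>)
  then show ?thesis by simp
qed

lemma sum_first:
  fixes f :: "nat \<Rightarrow> 'a::comm_monoid_add"
  assumes "\<And>k. 0 < k \<Longrightarrow> k \<le> n \<Longrightarrow> f k = 0"
  shows "sum f {..n} = f 0"
  by (subst sum.atMost_shift) (simp add: assms)

lemma sum_last:
  fixes f :: "nat \<Rightarrow> 'a::comm_monoid_add"
  assumes "\<And>k. k < n \<Longrightarrow> f k = 0"
  shows "sum f {..n} = f n"
  by (simp add: assms flip: lessThan_Suc_atMost)

text \<open>The integer shift \<open>m\<close> encodes the Laurent polynomial x^m p(x), so that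
  negative powers need no separate type.\<close>

definition moment_functional :: "(int \<Rightarrow> 'a::comm_ring_1) \<Rightarrow> int \<Rightarrow> 'a poly \<Rightarrow> 'a" where
  "moment_functional w m p = (\<Sum>i\<le>degree p. coeff p i * w (m + int i))"

lemma moment_functional_eq:
  assumes "degree p \<le> n"
  shows "moment_functional w m p = (\<Sum>i\<le>n. coeff p i * w (m + int i))"
  unfolding moment_functional_def
  by (rule sum.mono_neutral_left) (use assms in \<open>auto simp: coeff_eq_0\<close>)

lemma moment_functional_add:
  "moment_functional w m (p + q) = moment_functional w m p + moment_functional w m q"
proof -
  define n where "n = max (degree p) (degree q)"
  have "degree p \<le> n" "degree q \<le> n" "degree (p + q) \<le> n"
    by (auto simp: n_def degree_add_le)
  then show ?thesis
    by (simp add: moment_functional_eq[where n = n] sum.distrib algebra_simps)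
qed

lemma moment_functional_smult: "moment_functional w m (Polynomial.smult c p) = c * moment_functional w m p"
  using degree_smult_le[of c p]
  by (simp add: moment_functional_eq[where n = "degree p"] sum_distrib_left mult.assoc)

lemma moment_functional_pCons:
  "moment_functional w m (pCons c p) = c * w m + moment_functional w (m + 1) p"
proof -
  have "moment_functional w m (pCons c p)
      = (\<Sum>i\<le>Suc (degree p). coeff (pCons c p) i * w (m + int i))"
    by (rule moment_functional_eq) (rule degree_pCons_le)
  also have "\<dots> = c * w m + moment_functional w (m + 1) p"
    by (simp only: sum.atMost_Suc_shift moment_functional_def) (simp add: algebra_simps)
  finally show ?thesis .
qed

text \<open>Each monomial of \<open>q\<close> is absorbed into the shift, which reduces a product to
  moments of \<open>p\<close> alone.\<close>

lemma moment_functional_mult: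
  assumes "degree q \<le> n"
  shows "moment_functional w m (p * q) = (\<Sum>k\<le>n. coeff q k * moment_functional w (m + int k) p)"
  using assms
proof (induction n arbitrary: q m)
  case 0
  then obtain c where "q = [:c:]" by (auto elim: degree_eq_zeroE)
  then show ?case by (simp add: moment_functional_smult)
next
  case (Suc n)
  obtain c q' where q: "q = pCons c q'" by (cases q)
  have d: "degree q' \<le> n" using Suc.prems by (auto simp: q split: if_splits)
  have "moment_functional w m (p * q)
      = c * moment_functional w m p + moment_functional w (m + 1) (p * q')"
    by (simp add: q moment_functional_add moment_functional_smult moment_functional_pCons)
  also have "\<dots> = (\<Sum>k\<le>Suc n. coeff q k * moment_functional w (m + int k) p)"
    by (simp only: Suc.IH[OF d] q sum.atMost_Suc_shift) (simp add: algebra_simps)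
  finally show ?case .
qed

text \<open>A three-term recurrence for the moments is an integration by parts for the functional.\<close>

lemma moment_functional_pderiv:
  assumes "\<And>j. w (j - 1) - w (j + 1) = c * (\<mu> + of_int j) * w j"
  shows "c * (moment_functional w (m + 1) (pderiv p) + (\<mu> + of_int m) * moment_functional w m p)
       = moment_functional w (m - 1) p - moment_functional w (m + 1) p"
proof (induction p arbitrary: m)
  case 0
  then show ?case by (simp add: moment_functional_def)
next
  case (pCons a p)
  show ?case
    using pCons.IH[of "m + 1"] assms[of m]
    by (simp add: pderiv_pCons moment_functional_add moment_functional_pCons algebra_simps)
qed

section \<open>Orthogonal polynomials from Toeplitz cofactors\<close>

definition toeplitz :: "(int \<Rightarrow> 'a) \<Rightarrow> int \<Rightarrow> nat \<Rightarrow> 'a mat" where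
  "toeplitz w e n = Matrix.mat n n (\<lambda>(j, k). w (int j - int k + e))"

lemma toeplitz_carrier [simp]: "toeplitz w e n \<in> carrier_mat n n"
  by (simp add: toeplitz_def)

definition cofactor_poly :: "(int \<Rightarrow> 'a::field) \<Rightarrow> nat \<Rightarrow> nat \<Rightarrow> 'a poly" where
  "cofactor_poly w n k =
     (\<Sum>j\<le>n. monom (cofactor (toeplitz w 0 (Suc n)) j k / det (toeplitz w 0 n)) j)"

lemma coeff_cofactor_poly:
  "coeff (cofactor_poly w n k) j
     = (if j \<le> n then cofactor (toeplitz w 0 (Suc n)) j k / det (toeplitz w 0 n) else 0)"
  by (simp add: cofactor_poly_def coeff_sum if_distrib cong: if_cong)

lemma degree_cofactor_poly: "degree (cofactor_poly w n k) \<le> n"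
  by (rule degree_le) (simp add: coeff_cofactor_poly)

text \<open>This is row \<open>k\<close> of adj(T) T = det(T) 1, divided by the smaller
  determinant.\<close>

lemma moment_functional_cofactor_poly:
  assumes "k \<le> n" "l \<le> n"
  shows "moment_functional w (- int l) (cofactor_poly w n k)
       = (if l = k then det (toeplitz w 0 (Suc n)) / det (toeplitz w 0 n) else 0)"
proof -
  let ?T = "toeplitz w 0 (Suc n)"
  have "(adj_mat ?T * ?T) $$ (k, l) = (\<Sum>j\<le>n. cofactor ?T j k * w (int j - int l))"
    using assms by (simp add: adj_mat_def scalar_prod_def toeplitz_def atLeast0LessThan lessThan_Suc_atMost)
  moreover have "adj_mat ?T * ?T = det ?T \<cdot>\<^sub>m 1\<^sub>m (Suc n)"
    by (rule adj_mat(3)) simp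
  ultimately have "(\<Sum>j\<le>n. cofactor ?T j k * w (int j - int l)) = (if l = k then det ?T else 0)"
    using assms by auto
  then show ?thesis
    by (simp add: moment_functional_eq[OF degree_cofactor_poly] coeff_cofactor_poly
      sum_divide_distrib[symmetric] cong: if_cong)
qed

text \<open>Deleting a row and a column that meet in a corner leaves a Toeplitz matrix, offset by
  one diagonal at the two off-diagonal corners.\<close>

lemma cofactor_toeplitz_corner:
  "cofactor (toeplitz w 0 (Suc n)) n n = det (toeplitz w 0 n)"
  "cofactor (toeplitz w 0 (Suc n)) 0 0 = det (toeplitz w 0 n)"
  "cofactor (toeplitz w 0 (Suc n)) 0 n = (- 1) ^ n * det (toeplitz w 1 n)"
  "cofactor (toeplitz w 0 (Suc n)) n 0 = (- 1) ^ n * det (toeplitz w (- 1) n)"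
proof -
  have "mat_delete (toeplitz w 0 (Suc n)) n n = toeplitz w 0 n"
    "mat_delete (toeplitz w 0 (Suc n)) 0 0 = toeplitz w 0 n"
    "mat_delete (toeplitz w 0 (Suc n)) 0 n = toeplitz w 1 n"
    "mat_delete (toeplitz w 0 (Suc n)) n 0 = toeplitz w (- 1) n"
    by (auto simp: mat_delete_def toeplitz_def algebra_simps intro!: eq_matI)
  then show
    "cofactor (toeplitz w 0 (Suc n)) n n = det (toeplitz w 0 n)"
    "cofactor (toeplitz w 0 (Suc n)) 0 0 = det (toeplitz w 0 n)"
    "cofactor (toeplitz w 0 (Suc n)) 0 n = (- 1) ^ n * det (toeplitz w 1 n)"
    "cofactor (toeplitz w 0 (Suc n)) n 0 = (- 1) ^ n * det (toeplitz w (- 1) n)"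
    by (simp_all add: cofactor_def)
qed

section \<open>Reflection coefficients\<close>

locale regular_toeplitz =
  fixes w :: "int \<Rightarrow> 'a::field"
  assumes det_nonzero: "det (toeplitz w 0 n) \<noteq> 0"
begin

abbreviation "L \<equiv> moment_functional w"

text \<open>\<open>\<phi> n\<close> is the monic orthogonal polynomial of degree \<open>n\<close>, and \<open>\<psi> n\<close> is the
  reversal \<open>x\<^sup>n \<phi>'\<^sub>n(1/x)\<close> of its biorthogonal partner \<open>\<phi>'\<^sub>n\<close>.  Below, the same value
  \<open>L m (p * q)\<close> is repeatedly computed twice, expanding once in each factor.\<close>

definition "\<phi> n = cofactor_poly w n n"
definition "\<psi> n = cofactor_poly w n 0"
definition "h n = det (toeplitz w 0 (Suc n)) / det (toeplitz w 0 n)"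
definition "r n = (- 1) ^ n * det (toeplitz w 1 n) / det (toeplitz w 0 n)"
definition "r' n = (- 1) ^ n * det (toeplitz w (- 1) n) / det (toeplitz w 0 n)"

lemma degree_\<phi>_\<psi>: "degree (\<phi> n) \<le> n" "degree (\<psi> n) \<le> n"
  by (simp_all add: \<phi>_def \<psi>_def degree_cofactor_poly)

lemma coeff_ends [simp]:
  "coeff (\<phi> n) n = 1" "coeff (\<phi> n) 0 = r n" "coeff (\<psi> n) 0 = 1" "coeff (\<psi> n) n = r' n"
  by (simp_all add: \<phi>_def \<psi>_def r_def r'_def coeff_cofactor_poly cofactor_toeplitz_corner det_nonzero)

lemma h_nonzero: "h n \<noteq> 0"
  by (simp add: h_def det_nonzero)

lemma L_\<phi>: "- int n \<le> m \<Longrightarrow> m \<le> 0 \<Longrightarrow> L m (\<phi> n) = (if m = - int n then h n else 0)"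
  using moment_functional_cofactor_poly[of n n "nat (- m)" w] by (auto simp: \<phi>_def h_def)

lemma L_\<psi>: "- int n \<le> m \<Longrightarrow> m \<le> 0 \<Longrightarrow> L m (\<psi> n) = (if m = 0 then h n else 0)"
  using moment_functional_cofactor_poly[of 0 n "nat (- m)" w] by (auto simp: \<psi>_def h_def)

text \<open>The first moment above the orthogonality range, from two expansions of L(x^(-n) \<phi>_n
  \<phi>_(n+1)).\<close>

lemma L_1_\<phi>: "L 1 (\<phi> n) = - r (Suc n) * h n"
proof -
  have "L (- int n) (\<phi> (Suc n) * \<phi> n) = 0"
    by (simp add: moment_functional_mult[OF degree_\<phi>_\<psi>(1)] L_\<phi>)
  moreover have "L (- int n) (\<phi> n * \<phi> (Suc n)) = r (Suc n) * h n + L 1 (\<phi> n)"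
    unfolding moment_functional_mult[OF degree_\<phi>_\<psi>(1)]
    by (subst sum_ends) (simp_all add: L_\<phi>)
  ultimately show ?thesis by (simp add: mult.commute eq_neg_iff_add_eq_0 add.commute)
qed

lemma L_below_\<psi>: "L (- int n - 1) (\<psi> n) = - r' (Suc n) * h n"
proof -
  have "L (- int n - 1) (\<psi> (Suc n) * \<psi> n) = 0"
    by (simp add: moment_functional_mult[OF degree_\<phi>_\<psi>(2)] L_\<psi>)
  moreover have "L (- int n - 1) (\<psi> n * \<psi> (Suc n)) = L (- int n - 1) (\<psi> n) + r' (Suc n) * h n"
    unfolding moment_functional_mult[OF degree_\<phi>_\<psi>(2)]
    by (subst sum_ends) (simp_all add: L_\<psi>)
  ultimately show ?thesis by (simp add: mult.commute eq_neg_iff_add_eq_0)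
qed

lemma h_Suc: "h (Suc n) = h n * (1 - r (Suc n) * r' (Suc n))"
proof -
  have "L (- int n - 1) (\<phi> (Suc n) * \<psi> n) = h (Suc n)"
    unfolding moment_functional_mult[OF degree_\<phi>_\<psi>(2)]
    by (subst sum_first) (simp_all add: L_\<phi>)
  moreover have "L (- int n - 1) (\<psi> n * \<phi> (Suc n)) = r (Suc n) * L (- int n - 1) (\<psi> n) + h n"
    unfolding moment_functional_mult[OF degree_\<phi>_\<psi>(1)]
    by (subst sum_ends) (simp_all add: L_\<psi>)
  ultimately show ?thesis by (simp add: mult.commute L_below_\<psi> algebra_simps)
qed

text \<open>Keeps the denominator in the recurrence for \<open>ham_q\<close> away from zero.\<close>

lemma reflection_product_neq_1: "r (Suc n) * r' (Suc n) \<noteq> 1"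
  using h_Suc[of n] h_nonzero[of "Suc n"] by auto

lemma L_pderiv_mult:
  assumes "degree p \<le> n"
  shows "L m (q * pderiv p) = (\<Sum>k<n. of_nat (Suc k) * coeff p (Suc k) * L (m + int k) q)"
proof (cases n)
  case 0
  then show ?thesis using assms
    by (auto simp: moment_functional_def elim!: degree_eq_zeroE)
next
  case (Suc l)
  have "degree (pderiv p) \<le> l"
    by (rule degree_le) (use assms Suc in \<open>auto simp: coeff_pderiv coeff_eq_0\<close>)
  from moment_functional_mult[OF this] show ?thesis
    by (simp add: coeff_pderiv Suc lessThan_Suc_atMost del: of_nat_Suc)
qed

text \<open>Integration by parts applied to \<open>x\<^sup>-\<^sup>n \<phi>\<^sub>n \<psi>\<^sub>n\<close>.\<close>

lemma reflection_casorati: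
  assumes "\<And>j. w (j - 1) - w (j + 1) = c * (\<mu> + of_int j) * w j"
  shows "r (Suc n) * r' n - r n * r' (Suc n) = c * \<mu>"
proof -
  \<comment> \<open>Only the leading coefficient \<open>n\<close> of the derivative meets shift 0,
    where \<open>\<psi> n\<close> has moment \<open>h n\<close>.\<close>
  have 1: "L (1 - int n) (\<psi> n * pderiv (\<phi> n)) = of_nat n * h n"
  proof (cases n)
    case 0
    then show ?thesis by (simp add: L_pderiv_mult[OF degree_\<phi>_\<psi>(1)])
  next
    case (Suc l)
    then show ?thesis
      unfolding L_pderiv_mult[OF degree_\<phi>_\<psi>(1)] Suc lessThan_Suc_atMost
      by (subst sum_last) (simp_all add: L_\<psi> del: of_nat_Suc)
  qed
  have 2: "L (1 - int n) (\<phi> n * pderiv (\<psi> n)) = 0"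
    by (simp add: L_pderiv_mult[OF degree_\<phi>_\<psi>(2)] L_\<phi>)
  have 3: "L (- int n) (\<phi> n * \<psi> n) = h n"
    unfolding moment_functional_mult[OF degree_\<phi>_\<psi>(2)]
    by (subst sum_first) (simp_all add: L_\<phi>)
  have 4: "L (- int n - 1) (\<psi> n * \<phi> n) = - r n * r' (Suc n) * h n"
    unfolding moment_functional_mult[OF degree_\<phi>_\<psi>(1)]
    by (subst sum_first) (simp_all add: L_\<psi> L_below_\<psi>)
  have 5: "L (1 - int n) (\<phi> n * \<psi> n) = - r (Suc n) * r' n * h n"
    unfolding moment_functional_mult[OF degree_\<phi>_\<psi>(2)]
    by (subst sum_last) (simp_all add: L_\<phi> L_1_\<phi>)
  \<comment> \<open>The \<open>- n\<close> from the prefactor x^(-n) cancels the \<open>n\<close>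
    from the derivative.\<close>
  have "c * (of_nat n * h n + (\<mu> - of_nat n) * h n)
      = - r n * r' (Suc n) * h n + r (Suc n) * r' n * h n"
    using moment_functional_pderiv[of w c \<mu> "- int n" "\<phi> n * \<psi> n", OF assms] 1 2 3 4 5
    by (simp add: pderiv_mult moment_functional_add mult.commute[of "\<psi> n" "\<phi> n"])
  then have "(r (Suc n) * r' n - r n * r' (Suc n)) * h n = c * \<mu> * h n"
    by (simp add: algebra_simps)
  then show ?thesis using h_nonzero by simp
qed

text \<open>Integration by parts applied to \<open>x\<^sup>-\<^sup>n \<phi>\<^sub>n \<phi>\<^sub>n\<^sub>+\<^sub>1\<close>.\<close>

lemma reflection_three_term:
  assumes "\<And>j. w (j - 1) - w (j + 1) = c * (\<mu> + of_int j) * w j"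
  shows "(r n + r (Suc (Suc n))) * (1 - r (Suc n) * r' (Suc n)) = - c * of_nat (Suc n) * r (Suc n)"
proof -
  have 1: "L (1 - int n) (\<phi> n * pderiv (\<phi> (Suc n))) = - of_nat (Suc n) * r (Suc n) * h n"
    unfolding L_pderiv_mult[OF degree_\<phi>_\<psi>(1)] lessThan_Suc_atMost
    by (subst sum_last) (simp_all add: L_\<phi> L_1_\<phi> del: of_nat_Suc)
  have 2: "L (1 - int n) (\<phi> (Suc n) * pderiv (\<phi> n)) = 0"
    by (simp add: L_pderiv_mult[OF degree_\<phi>_\<psi>(1)] L_\<phi>)
  \<comment> \<open>This orthogonality removes the term that carries \<mu>.\<close>
  have 3: "L (- int n) (\<phi> (Suc n) * \<phi> n) = 0"
    by (simp add: moment_functional_mult[OF degree_\<phi>_\<psi>(1)] L_\<phi>)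
  have 4: "L (- int n - 1) (\<phi> (Suc n) * \<phi> n) = r n * h (Suc n)"
    unfolding moment_functional_mult[OF degree_\<phi>_\<psi>(1)]
    by (subst sum_first) (simp_all add: L_\<phi>)
  have 5: "L (1 - int n) (\<phi> (Suc n) * \<phi> n) = - r (Suc (Suc n)) * h (Suc n)"
    unfolding moment_functional_mult[OF degree_\<phi>_\<psi>(1)]
    by (subst sum_last) (simp_all add: L_\<phi> L_1_\<phi>)
  have "c * (- of_nat (Suc n) * r (Suc n) * h n) = (r n + r (Suc (Suc n))) * h (Suc n)"
    using moment_functional_pderiv[of w c \<mu> "- int n" "\<phi> (Suc n) * \<phi> n", OF assms]
    by (simp add: pderiv_mult moment_functional_add 1 2 3 4 5 distrib_right del: of_nat_Suc)
  then have "(r n + r (Suc (Suc n))) * (1 - r (Suc n) * r' (Suc n)) * h n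
      = - c * of_nat (Suc n) * r (Suc n) * h n"
    by (simp add: h_Suc algebra_simps del: of_nat_Suc)
  then show ?thesis by (rule iffD1[OF mult_right_cancel[OF h_nonzero]])
qed

end

section \<open>Modified Bessel functions\<close>

text \<open>\<open>I\<^sub>a(2 z) = z\<^sup>a bessel_entire a (z\<^sup>2)\<close>.\<close>

definition bessel_entire :: "complex \<Rightarrow> complex \<Rightarrow> complex" where
  "bessel_entire a u = (\<Sum>k. rGamma (a + of_nat k + 1) / fact k * u ^ k)"

lemma summable_bessel_entire:
  "summable (\<lambda>k. rGamma (a + of_nat k + 1) / fact k * (u::complex) ^ k)"
proof (rule summable_ratio_test[where c = "1/2"])
  show "(1/2::real) < 1" by simp
next
  fix k :: nat
  \<comment> \<open>From this index on, |a + k + 1| \<ge> 1 and |u| / (k + 1) \<le> 1/2.\<close>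
  assume "k \<ge> nat \<lceil>2 * norm u + norm a\<rceil>"
  then have k: "2 * norm u + norm a \<le> real k" by linarith
  define b where "b = a + of_nat k + 1"
  have "b - a = of_nat (Suc k)" by (simp add: b_def)
  then have "real (Suc k) = norm (b - a)" by (simp only: norm_of_nat)
  also have "\<dots> \<le> norm b + norm a" by (rule norm_triangle_ineq4)
  finally have b: "1 \<le> norm b" using k norm_ge_zero[of u] by linarith
  have "norm (rGamma (b + 1)) \<le> norm b * norm (rGamma (b + 1))"
    using mult_right_mono[OF b, of "norm (rGamma (b + 1))"] by simp
  also have "\<dots> = norm (rGamma b)" by (simp add: rGamma_plus1 flip: norm_mult)
  finally have 1: "norm (rGamma (b + 1)) \<le> norm (rGamma b)" .
  have "2 * norm u \<le> real (Suc k)"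
    using k norm_ge_zero[of a] unfolding of_nat_Suc by linarith
  then have 2: "norm u / real (Suc k) \<le> 1/2"
    by (simp add: field_simps)
  have "norm (rGamma (a + of_nat (Suc k) + 1) / fact (Suc k) * u ^ Suc k)
      = (norm u / real (Suc k)) * (norm (rGamma (b + 1)) * (norm u ^ k / fact k))"
    by (simp add: b_def norm_mult norm_divide norm_power add_ac del: of_nat_Suc)
       (simp add: norm_mult add_ac)
  also have "\<dots> \<le> 1/2 * (norm (rGamma b) * (norm u ^ k / fact k))"
    by (intro mult_mono 1 2 mult_right_mono) auto
  also have "\<dots> = 1/2 * norm (rGamma (a + of_nat k + 1) / fact k * u ^ k)"
    by (simp add: b_def norm_mult norm_divide norm_power)
  finally show "norm (rGamma (a + of_nat (Suc k) + 1) / fact (Suc k) * u ^ Suc k)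
      \<le> 1/2 * norm (rGamma (a + of_nat k + 1) / fact k * u ^ k)" .
qed

lemma DERIV_bessel_entire: "(bessel_entire a has_field_derivative bessel_entire (a + 1) u) (at u)"
proof -
  have "diffs (\<lambda>k. rGamma (a + of_nat k + 1) / fact k)
      = (\<lambda>k. rGamma (a + 1 + of_nat k + 1) / fact k :: complex)"
    by (rule ext) (simp add: diffs_def add_ac del: of_nat_Suc, simp add: add_ac)
  with termdiffs_strong_converges_everywhere[OF summable_bessel_entire[of a], of u]
  show ?thesis by (simp add: bessel_entire_def[abs_def])
qed

lemma bessel_entire_contiguous:
  "bessel_entire (a - 1) u - u * bessel_entire (a + 1) u = a * bessel_entire a u"
proof -
  define f where "f a k = rGamma (a + of_nat k + 1) / fact k * u ^ k" for a :: complex and k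
  have f: "summable (f a)" "bessel_entire a u = suminf (f a)" for a
    using summable_bessel_entire by (simp_all add: f_def[abs_def] bessel_entire_def)
  have 0: "f (a - 1) 0 = a * f a 0"
    by (simp add: f_def rGamma_plus1)
  \<comment> \<open>At equal powers of \<open>u\<close> the two terms carry the factors a + k + 1
    and k + 1, whose difference is \<open>a\<close>.\<close>
  have Suc: "f (a - 1) (Suc k) - u * f (a + 1) k = a * f a (Suc k)" for k
  proof -
    define R where "R = rGamma (a + of_nat (Suc k) + 1) * u ^ Suc k"
    have "f (a - 1) (Suc k) = (a + of_nat (Suc k)) * R / fact (Suc k)"
      using rGamma_plus1[of "a + of_nat (Suc k)"]
      by (simp add: f_def R_def add_ac flip: mult.assoc)
    moreover have "u * f (a + 1) k = of_nat (Suc k) * R / fact (Suc k)"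
      by (simp add: f_def R_def add_ac divide_simps del: of_nat_Suc fact_Suc)
         (simp add: add_ac)
    ultimately show ?thesis
      by (simp only: f_def R_def) (simp add: divide_simps algebra_simps del: of_nat_Suc fact_Suc)
  qed
  have s: "summable (\<lambda>k. f b (Suc k))" for b
    using f(1)[of b] by (simp only: summable_Suc_iff)
  have head: "bessel_entire b u = f b 0 + (\<Sum>k. f b (Suc k))" for b
    using suminf_split_head[OF f(1)[of b]] f(2)[of b] by simp
  have "(\<Sum>k. f (a - 1) (Suc k)) - u * bessel_entire (a + 1) u
      = (\<Sum>k. f (a - 1) (Suc k) - u * f (a + 1) k)"
    by (simp add: f(2) suminf_mult[OF f(1), symmetric] suminf_diff s f(1) summable_mult)
  also have "\<dots> = a * (\<Sum>k. f a (Suc k))"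
    by (simp add: Suc suminf_mult s)
  finally show ?thesis
    by (simp add: head[of "a - 1"] head[of a] 0 algebra_simps)
qed

lemma bessel_I_eq: "bessel_I a (2 * z) = z powr a * bessel_entire a (z\<^sup>2)"
  by (simp add: bessel_I_def bessel_entire_def mult.commute flip: power_mult)

lemma bessel_I_contiguous:
  assumes "z \<noteq> 0"
  shows "bessel_I (a - 1) (2 * z) - bessel_I (a + 1) (2 * z) = 1 / z * a * bessel_I a (2 * z)"
proof -
  have "z * z powr (a - 1) = z powr a" "z powr (a + 1) = z * z powr a"
    using assms by (simp_all add: powr_diff powr_add)
  then have "z * (bessel_I (a - 1) (2 * z) - bessel_I (a + 1) (2 * z))
      = z powr a * (bessel_entire (a - 1) (z\<^sup>2) - z\<^sup>2 * bessel_entire (a + 1) (z\<^sup>2))"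
    unfolding bessel_I_eq by (simp add: algebra_simps power2_eq_square)
  also have "\<dots> = a * bessel_I a (2 * z)"
    by (simp add: bessel_entire_contiguous bessel_I_eq)
  finally show ?thesis
    using assms by (simp add: field_simps)
qed

text \<open>The branched powers cancel up to a constant, so the function defining q_0 can be
  differentiated as a power series.\<close>

lemma powr_times_bessel_I:
  assumes "s \<noteq> 0"
  shows "s powr (- \<mu> / 2) * bessel_I \<mu> (csqrt s) = 2 powr (- \<mu>) * bessel_entire \<mu> (s / 4)"
proof -
  define z where "z = csqrt s / 2"
  have z: "csqrt s = 2 * z" "z \<noteq> 0" "z\<^sup>2 = s / 4"
    using assms by (auto simp: z_def power_divide)
  \<comment> \<open>Halving the imaginary part of \<open>Ln s\<close> keeps it in the principal
    strip, and \<open>Ln 2\<close> is real.\<close>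
  have "Ln z = Ln s / 2 - Ln 2"
  proof (rule Ln_unique)
    show "exp (Ln s / 2 - Ln 2) = z"
      using assms by (simp add: exp_diff z_def csqrt_exp_Ln)
    have "Im (Ln s / 2 - Ln 2) = Im (Ln s) / 2"
      using Ln_of_real[of 2] by simp
    then show "- pi < Im (Ln s / 2 - Ln 2)" "Im (Ln s / 2 - Ln 2) \<le> pi"
      using mpi_less_Im_Ln[OF assms] Im_Ln_le_pi[OF assms] pi_gt_zero by linarith+
  qed
  then have "Ln s = 2 * (Ln z + Ln 2)" by simp
  then have "- \<mu> / 2 * Ln s + \<mu> * Ln z = - \<mu> * Ln 2"
    by (simp add: algebra_simps)
  then have "s powr (- \<mu> / 2) * z powr \<mu> = 2 powr (- \<mu>)"
    using assms z(2) by (simp add: powr_def flip: exp_add)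
  then show ?thesis by (simp add: z bessel_I_eq flip: mult.assoc)
qed

text \<open>Differentiating \<open>bessel_entire\<close> raises the order by one; this turns q_0
  into a ratio of moments and hence into -z r_1 / r_0.\<close>

lemma log_derivative_bessel_I:
  assumes "z \<noteq> 0" "bessel_I \<mu> (2 * z) \<noteq> 0"
  shows "4 * z\<^sup>2 * log_derivative (\<lambda>s. s powr (- \<mu> / 2) * bessel_I \<mu> (csqrt s)) (4 * z\<^sup>2)
       = z * bessel_I (\<mu> + 1) (2 * z) / bessel_I \<mu> (2 * z)"
proof -
  have ev: "\<forall>\<^sub>F s in nhds (4 * z\<^sup>2).
      s powr (- \<mu> / 2) * bessel_I \<mu> (csqrt s) = 2 powr (- \<mu>) * bessel_entire \<mu> (s / 4)"
  proof (rule eventually_mono)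
    show "\<forall>\<^sub>F s in nhds (4 * z\<^sup>2). s \<in> - {0}"
      using assms(1) by (intro eventually_nhds_in_open) auto
  qed (rule powr_times_bessel_I, simp)
  have "((\<lambda>s. 2 powr (- \<mu>) * bessel_entire \<mu> (s / 4)) has_field_derivative
      2 powr (- \<mu>) * (bessel_entire (\<mu> + 1) (z\<^sup>2) * (1 / 4))) (at (4 * z\<^sup>2))"
    by (auto intro!: derivative_eq_intros DERIV_chain2[OF DERIV_bessel_entire])
  then have "deriv (\<lambda>s. s powr (- \<mu> / 2) * bessel_I \<mu> (csqrt s)) (4 * z\<^sup>2)
      = 2 powr (- \<mu>) * (bessel_entire (\<mu> + 1) (z\<^sup>2) * (1 / 4))"
    unfolding deriv_cong_ev[OF ev refl] by (rule DERIV_imp_deriv)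
  moreover have "(4 * z\<^sup>2) powr (- \<mu> / 2) * bessel_I \<mu> (csqrt (4 * z\<^sup>2))
      = 2 powr (- \<mu>) * bessel_entire \<mu> (z\<^sup>2)"
    using assms(1) by (subst powr_times_bessel_I) simp_all
  ultimately show ?thesis
    using assms unfolding log_derivative_def
    by (simp only:) (simp add: bessel_I_eq powr_add power2_eq_square)
qed

section \<open>The Hamiltonian variables\<close>

theorem proposition3p3:
  fixes \<mu> t :: complex
  assumes "t \<notin> \<real>\<^sub>\<le>\<^sub>0"
    and "\<And>N. toeplitz_I \<mu> 0 N (4 * t) \<noteq> 0"
    and "\<And>N. refl_coeff \<mu> N (4 * t) \<noteq> 0"
  shows "\<forall>N. ham_p \<mu> N t = 1 - refl_coeff \<mu> N (4 * t) * refl_coeff_bar \<mu> N (4 * t)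
           \<and> ham_q \<mu> N t = - csqrt t * (refl_coeff \<mu> (N + 1) (4 * t) / refl_coeff \<mu> N (4 * t))"
proof -
  define z where "z = csqrt t"
  have z: "z \<noteq> 0" "z\<^sup>2 = t" using assms(1) by (auto simp: z_def)
  have sq: "csqrt (4 * t) = 2 * z"
    using csqrt_principal[of t] by (intro csqrt_unique) (auto simp: z_def power_mult_distrib)
  define w where "w j = bessel_I (\<mu> + of_int j) (2 * z)" for j
  have T: "toeplitz_I \<mu> e N (4 * t) = det (toeplitz w e N)" for e N
    by (simp add: toeplitz_I_def toeplitz_def w_def sq add_ac diff_conv_add_uminus del: add_uminus_conv_diff)
  interpret regular_toeplitz w
    by unfold_locales (use assms(2) T in auto)
  have rr: "refl_coeff \<mu> N (4 * t) = r N" "refl_coeff_bar \<mu> N (4 * t) = r' N" for N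
    by (simp_all add: refl_coeff_def refl_coeff_bar_def r_def r'_def T)
  have r_nz: "r N \<noteq> 0" for N using assms(3)[of N] by (simp add: rr)
  have rec: "w (j - 1) - w (j + 1) = 1 / z * (\<mu> + of_int j) * w j" for j
    using bessel_I_contiguous[OF z(1), of "\<mu> + of_int j"] by (simp add: w_def algebra_simps)
  note A = reflection_casorati[OF rec] and B = reflection_three_term[OF rec]
  have r0: "r 0 = 1" "r' 0 = 1" by (simp_all add: r_def r'_def toeplitz_def)
  have r1: "r 1 = - w 1 / w 0" by (simp add: r_def toeplitz_def det_single)
  have w0: "w 0 \<noteq> 0" using det_nonzero[of 1] by (simp add: toeplitz_def det_single)
  have "ham_p \<mu> N t = 1 - r N * r' N \<and> ham_q \<mu> N t = - z * (r (N + 1) / r N)" for N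
  proof (induction N)
    case 0
    have "ham_q \<mu> 0 t = z * w 1 / w 0"
      using log_derivative_bessel_I[OF z(1), of \<mu>] w0 by (simp add: w_def z(2))
    then show ?case using r1 by (simp add: r0)
  next
    case (Suc N)
    define p q where "p = ham_p \<mu> N t" and "q = ham_q \<mu> N t"
    have p: "p = 1 - r N * r' N" and q: "q = - z * (r (Suc N) / r N)"
      using Suc by (simp_all add: p_def q_def)
    have q_nz: "q \<noteq> 0" using z r_nz by (simp add: q)
    define P where "P = 1 - r (Suc N) * r' (Suc N)"
    have P_nz: "P \<noteq> 0" using reflection_product_neq_1[of N] by (simp add: P_def)
    have "z * (r (Suc N) * r' N - r N * r' (Suc N)) = \<mu>"
      using A[of N] z by simp
    \<comment> \<open>Here \<open>q * (p - 1) = z * r (Suc N) * r' N\<close>, so subtracting \<mu>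
      leaves \<open>z * r N * r' (Suc N)\<close>. The result serves both recurrences: divided by
      \<open>t\<close> it is the new p, and it is the denominator for the new q.\<close>
    then have num: "q * (q * (p - 1) - \<mu>) + t = t * P"
      using r_nz[of N] by (simp add: p q P_def z(2)[symmetric] power2_eq_square field_simps)
    have pS: "ham_p \<mu> (Suc N) t = P"
    proof -
      have "ham_p \<mu> (Suc N) t = (q * (q * (p - 1) - \<mu>) + t) / t"
        using z(1) z(2)[symmetric]
        by (simp add: p_def q_def add_divide_distrib diff_divide_distrib algebra_simps power2_eq_square)
      then show ?thesis using num z by auto
    qed
    have "ham_q \<mu> (Suc N) t = - (t / q) + of_nat (N + 1) / P"
      using num z by (simp add: p_def q_def del: of_nat_Suc) auto
    also have "t / q = - z * r N / r (Suc N)"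
      using z r_nz by (simp add: q z(2)[symmetric] power2_eq_square)
    \<comment> \<open>The three-term relation solved for (N + 1) / P; its \<open>r N\<close> part
      cancels against -t/q.\<close>
    also have "of_nat (N + 1) / P = - z * (r N + r (Suc (Suc N))) / r (Suc N)"
      using B[of N] z P_nz r_nz[of "Suc N"] by (simp add: P_def field_simps del: of_nat_Suc)
    finally have "ham_q \<mu> (Suc N) t = - z * (r (Suc N + 1) / r (Suc N))"
      using r_nz[of "Suc N"] by (simp add: field_simps)
    with pS show ?case by (simp add: P_def)
  qed
  then show ?thesis by (simp add: rr z_def)
qed

end
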